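(* Let $p\in(0,1]$ and let $\{\varphi_n(r)\}_{n=0}^\infty\in\mathcal F$, with $\Phi_1(r)=\sum_{n=1}^\infty\varphi_n(r)$. Let $R\in(0,1)$ be the minimal positive root of the equation $\varphi_0(x)=\frac1p\Phi_1(x)$, and suppose that $\varphi_0(r)\ge\frac1p\Phi_1(r)$ for all $r\in[0,R]$. Then for every $f\in\mathcal B'$, $f(z)=\sum_{n=0}^\infty a_nz^n$, one has $$|a_0|^p\varphi_0(r)+\sum_{n=1}^\infty|a_n|\varphi_n(r)\le\varphi_0(r)\quad\text{for all } r\in[0,R].$$ Moreover, if $\varphi_0(x)<\frac1p\Phi_1(x)$ for all $x$ in some interval $(R,R+\epsilon)\subset(0,1)$ with $\epsilon>0$, then the number $R$ cannot be improved: for every $R'\in(R,1)$ there exist $f\in\mathcal B'$, $f(z)=\sum_{n=0}^\infty a_nz^n$, and $r\in(R,R')$ such that $|a_0|^p\varphi_0(r)+\sum_{n=1}^\infty|a_n|\varphi_n(r)>\varphi_0(r)$.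
   Context: $\mathbb D=\{z\in\mathbb C:|z|<1\}$. $\mathcal B$ is the class of all analytic functions $\omega$ in $\mathbb D$ with $|\omega(z)|\le1$ for all $z\in\mathbb D$. $\mathcal B'$ is the class of all $f(z)=\sum_{k=0}^\infty a_kz^k\in\mathcal B$ such that $|a_n|\le1-|a_0|$ for all $n\ge1$. $\mathcal F$ is the set of all sequences $\{\varphi_n(r)\}_{n=0}^\infty$ of nonnegative continuous functions on $[0,1)$ such that $\sum_{n=0}^\infty\varphi_n(r)$ converges locally uniformly with respect to $r\in[0,1)$. *)

theory Defs
  imports "HOL-Complex_Analysis.Complex_Analysis"
begin

definition class_B :: "(complex \<Rightarrow> complex) set" where
  "class_B = {f. f analytic_on ball 0 1 \<and> (\<forall>z\<in>ball 0 1. norm (f z) \<le> 1)}"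

definition has_expansion :: "(complex \<Rightarrow> complex) \<Rightarrow> (nat \<Rightarrow> complex) \<Rightarrow> bool" where
  "has_expansion f a \<longleftrightarrow> (\<forall>z\<in>ball 0 1. (\<lambda>n. a n * z ^ n) sums f z)"

definition class_B' :: "(complex \<Rightarrow> complex) set" where
  "class_B' = {f \<in> class_B. \<exists>a. has_expansion f a \<and> (\<forall>n\<ge>1. norm (a n) \<le> 1 - norm (a 0))}"

text \<open>The functions are total on the reals; only their values on \<open>[0,1)\<close> are constrained.
  Locally uniform convergence on \<open>[0,1)\<close> means uniform convergence on some relative
  neighbourhood of each point.\<close>

definition class_F :: "(nat \<Rightarrow> real \<Rightarrow> real) set" where
  "class_F = {\<phi>.
     (\<forall>n. continuous_on {0..<1} (\<phi> n)) \<and>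
     (\<forall>n. \<forall>r\<in>{0..<1}. 0 \<le> \<phi> n r) \<and>
     (\<forall>r\<in>{0..<1}. \<exists>U. openin (top_of_set {0..<1}) U \<and> r \<in> U \<and>
        uniformly_convergent_on U (\<lambda>N x. \<Sum>n<N. \<phi> n x))}"

definition Phi1 :: "(nat \<Rightarrow> real \<Rightarrow> real) \<Rightarrow> real \<Rightarrow> real" where
  "Phi1 \<phi> r = (\<Sum>n. \<phi> (Suc n) r)"

text \<open>For \<open>p > 0\<close> the convention \<open>0 powr p = 0\<close> gives the intended value of \<open>\<bar>a\<^sub>0\<bar>\<^sup>p\<close> also at
  \<open>a\<^sub>0 = 0\<close>.  The series converges for \<open>\<phi>\<close> in \<^const>\<open>class_F\<close>, \<open>r \<in> [0,1)\<close> and coefficients of a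
  function in \<^const>\<open>class_B'\<close>, since these satisfy \<open>\<bar>a\<^sub>n\<bar> \<le> 1\<close>.\<close>

definition majorant :: "real \<Rightarrow> (nat \<Rightarrow> real \<Rightarrow> real) \<Rightarrow> (nat \<Rightarrow> complex) \<Rightarrow> real \<Rightarrow> real" where
  "majorant p \<phi> a r =
     norm (a 0) powr p * \<phi> 0 r + (\<Sum>n. norm (a (Suc n)) * \<phi> (Suc n) r)"

end

theory Submission
  imports Defs
begin

text \<open>
  Write \<open>t = \<bar>a\<^sub>0\<bar>\<close>. In the class \<^const>\<open>class_B'\<close> every later coefficient is at most \<open>1 - t\<close>,
  so the majorant series is at most \<open>t\<^sup>p \<phi>\<^sub>0 + (1 - t) \<Phi>\<^sub>1\<close>. On \<open>[0,R]\<close> one has \<open>\<Phi>\<^sub>1 \<le> p \<phi>\<^sub>0\<close>, and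
  \<open>p (1 - t) \<le> 1 - t\<^sup>p\<close> because the concave function \<open>t\<^sup>p\<close> stays below its tangent at \<open>1\<close>
  (\<open>powr_le_tangent_at_1\<close>). This gives the inequality.

  Both estimates are asymptotically sharp as \<open>t \<rightarrow> 1\<close> for functions with \<open>a\<^sub>0 \<rightarrow> 1\<close>
  whose other coefficients, each for itself, have modulus asymptotic to \<open>1 - a\<^sub>0\<close>. The functions
  \<open>1 - (1 - a) / (1 - a z) = a - (1 - a) (a z + a\<^sup>2 z\<^sup>2 + \<dots>)\<close> have this property
  (\<open>near_one_in_class_B'\<close>). For them, at a fixed \<open>r\<close>, the majorant minus \<open>\<phi>\<^sub>0\<close> equals
  \<open>(1 - a) \<Sum> a\<^sup>n \<phi>\<^sub>n - (1 - a\<^sup>p) \<phi>\<^sub>0\<close>. It vanishes at \<open>a = 1\<close> with one-sided slope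
  \<open>p \<phi>\<^sub>0 - \<Phi>\<^sub>1\<close>, so it is positive for \<open>a\<close> slightly below \<open>1\<close> wherever \<open>p \<phi>\<^sub>0 < \<Phi>\<^sub>1\<close>
  (\<open>weighted_geometric_sum_exceeds\<close>).
\<close>

text \<open>The class \<^const>\<open>class_B'\<close> asks for some expansion with small coefficients; uniqueness
  transfers the coefficient bound to every expansion of the function.\<close>

lemma has_expansion_unique:
  assumes "has_expansion f a" "has_expansion f b"
  shows "a = b"
proof (rule ccontr)
  assume "a \<noteq> b"
  then obtain m where m: "a m \<noteq> b m" by auto
  have diff: "(\<lambda>n. (a n - b n) * (z - 0) ^ n) sums 0" if "norm (z - 0) < 1" for z
  proof -
    have "(\<lambda>n. a n * z ^ n - b n * z ^ n) sums (f z - f z)"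
      using assms that by (intro sums_diff) (auto simp: has_expansion_def)
    then show ?thesis by (simp add: algebra_simps)
  qed
  have "(\<lambda>n. (a n - b n) * 0 ^ n) sums 0" using diff[of 0] by simp
  then have "a 0 = b 0" by simp
  with m have "m > 0" by (cases m) auto
  from powser_0_nonzero[of 1 0 "\<lambda>n. a n - b n" "\<lambda>_. 0" m] diff m this
  obtain s where "0 < s" and "\<And>z::complex. z \<in> cball 0 s - {0} \<Longrightarrow> (0::complex) \<noteq> 0"
    by auto
  moreover from \<open>0 < s\<close> have "complex_of_real s \<in> cball 0 s - {0}" by simp
  ultimately show False by blast
qed

lemma class_B'_coeff_le:
  assumes "f \<in> class_B'" "has_expansion f a"
  shows "norm (a 0) \<le> 1" and "n \<ge> 1 \<Longrightarrow> norm (a n) \<le> 1 - norm (a 0)"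
proof -
  from assms(1) obtain b where "has_expansion f b" "\<forall>n\<ge>1. norm (b n) \<le> 1 - norm (b 0)"
    by (auto simp: class_B'_def)
  with has_expansion_unique[OF assms(2)] have *: "\<forall>n\<ge>1. norm (a n) \<le> 1 - norm (a 0)" by simp
  then show "n \<ge> 1 \<Longrightarrow> norm (a n) \<le> 1 - norm (a 0)" by simp
  have "0 \<le> norm (a 1)" by (rule norm_ge_zero)
  also have "\<dots> \<le> 1 - norm (a 0)" using * by blast
  finally show "norm (a 0) \<le> 1" by simp
qed

lemma class_F_nonneg: "\<phi> \<in> class_F \<Longrightarrow> r \<in> {0..<1} \<Longrightarrow> 0 \<le> \<phi> n r"
  by (auto simp: class_F_def)

lemma class_F_summable_Suc:
  assumes "\<phi> \<in> class_F" "r \<in> {0..<1}"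
  shows "summable (\<lambda>n. \<phi> (Suc n) r)"
proof -
  from assms have "\<exists>U. openin (top_of_set {0..<1}) U \<and> r \<in> U \<and>
      uniformly_convergent_on U (\<lambda>N x. \<Sum>n<N. \<phi> n x)"
    by (simp only: class_F_def mem_Collect_eq)
  then obtain U where "r \<in> U" "uniformly_convergent_on U (\<lambda>N x. \<Sum>n<N. \<phi> n x)"
    by blast
  then have "convergent (\<lambda>N. \<Sum>n<N. \<phi> n r)"
    by (intro uniformly_convergent_imp_convergent)
  then have "summable (\<lambda>n. \<phi> n r)" by (simp only: summable_iff_convergent)
  then show ?thesis by (simp only: summable_Suc_iff[of "\<lambda>n. \<phi> n r"])
qed

lemma powr_le_tangent_at_1:
  fixes t p :: real
  assumes "0 \<le> t" "0 < p" "p \<le> 1"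
  shows "t powr p \<le> 1 - p * (1 - t)"
proof (cases "t = 0")
  case False
  then show ?thesis
    using Youngs_inequality_0[of p "1 - p" t 1] assms by (simp add: algebra_simps)
qed (use assms in simp)

lemma majorant_le_if_Phi1_le:
  assumes "\<phi> \<in> class_F" "r \<in> {0..<1}" "0 < p" "p \<le> 1"
    and le: "Phi1 \<phi> r \<le> p * \<phi> 0 r"
    and f: "f \<in> class_B'" "has_expansion f a"
  shows "majorant p \<phi> a r \<le> \<phi> 0 r"
proof -
  define t where "t = norm (a 0)"
  have t: "0 \<le> t" "t \<le> 1" using class_B'_coeff_le(1)[OF f] by (auto simp: t_def)
  note nonneg = class_F_nonneg[OF assms(1,2)]
  note sm = summable_mult[OF class_F_summable_Suc[OF assms(1,2)], of "1 - t"]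
  have bound: "norm (a (Suc n)) * \<phi> (Suc n) r \<le> (1 - t) * \<phi> (Suc n) r" for n
    using class_B'_coeff_le(2)[OF f, of "Suc n"] nonneg by (auto simp: t_def intro: mult_right_mono)
  have "summable (\<lambda>n. norm (a (Suc n)) * \<phi> (Suc n) r)"
    by (rule summable_comparison_test'[OF sm, of 0]) (use bound nonneg in \<open>simp add: abs_mult\<close>)
  then have "(\<Sum>n. norm (a (Suc n)) * \<phi> (Suc n) r) \<le> (\<Sum>n. (1 - t) * \<phi> (Suc n) r)"
    by (intro suminf_le bound sm)
  also have "\<dots> = (1 - t) * Phi1 \<phi> r"
    using class_F_summable_Suc[OF assms(1,2)] by (simp add: Phi1_def suminf_mult)
  also have "\<dots> \<le> (1 - t) * (p * \<phi> 0 r)"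
    using le t by (intro mult_left_mono) auto
  finally have "majorant p \<phi> a r \<le> (t powr p + p * (1 - t)) * \<phi> 0 r"
    by (simp add: majorant_def t_def algebra_simps)
  also have "\<dots> \<le> 1 * \<phi> 0 r"
    using powr_le_tangent_at_1[OF t(1) assms(3,4)] nonneg by (intro mult_right_mono) auto
  finally show ?thesis by simp
qed

text \<open>The map sends the disc into a disc with diameter \<open>[0, 2 a / (1 + a)]\<close>. The bound by \<open>1\<close> comes from writing the function as
  \<open>a (1 - z) / (1 - a z)\<close>: numerator and denominator have imaginary parts of equal size, and the
  denominator has the larger real part.\<close>

lemma near_one_in_class_B':
  fixes a :: real
  assumes "0 < a" "a < 1"
  defines "f \<equiv> \<lambda>z. 1 - (1 - of_real a) / (1 - of_real a * z)"
    and "c \<equiv> \<lambda>n. if n = 0 then of_real a else - of_real ((1 - a) * a ^ n)"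
  shows "f \<in> class_B'" and "has_expansion f c"
    and "n \<ge> 1 \<Longrightarrow> norm (c n) = (1 - a) * a ^ n"
proof -
  have norm_c: "norm (c n) = (1 - a) * a ^ n" if "n \<ge> 1" for n
  proof -
    have "norm (c n) = norm (complex_of_real ((1 - a) * a ^ n))"
      using that unfolding c_def by (simp del: of_real_mult of_real_power of_real_diff)
    then show ?thesis using assms by (simp only: norm_of_real) (simp add: abs_mult)
  qed
  then show "n \<ge> 1 \<Longrightarrow> norm (c n) = (1 - a) * a ^ n" .
  have az: "norm (of_real a * z) < 1" if "norm z < 1" for z :: complex
  proof -
    have "a * norm z \<le> 1 * norm z" using assms by (intro mult_right_mono) auto
    then show ?thesis using that assms by (simp add: norm_mult)
  qed
  then have nz: "1 - of_real a * z \<noteq> 0" if "norm z < 1" for z :: complex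
    using that by force
  have "f analytic_on ball 0 1"
    unfolding f_def by (intro analytic_intros) (use nz in auto)
  moreover have "norm (f z) \<le> 1" if z: "norm z < 1" for z
  proof -
    have eq: "f z = of_real a * (1 - z) / (1 - of_real a * z)"
      using nz[OF z] by (simp add: f_def field_simps)
    have "Re z < 1" using z complex_Re_le_cmod[of z] by linarith
    then have "0 \<le> a * (1 - Re z)" "a * (1 - Re z) \<le> 1 - a * Re z"
      using assms by (auto simp: algebra_simps)
    then have "(a * (1 - Re z))\<^sup>2 \<le> (1 - a * Re z)\<^sup>2" by (intro power_mono)
    then have "norm (of_real a * (1 - z)) \<le> norm (1 - of_real a * z)"
      by (simp add: cmod_def)
    then show ?thesis using nz[OF z] by (simp add: eq norm_divide)
  qed
  ultimately have B: "f \<in> class_B" by (simp add: class_B_def)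
  have "(\<lambda>n. c n * z ^ n) sums f z" if z: "norm z < 1" for z
  proof -
    have "(\<lambda>n. (1 - of_real a) * (of_real a * z) ^ n) sums ((1 - of_real a) * (1 / (1 - of_real a * z)))"
      by (intro sums_mult geometric_sums az z)
    then have "(\<lambda>n. (if n = 0 then 1 else 0) - (1 - of_real a) * (of_real a * z) ^ n) sums f z"
      using sums_diff[OF sums_single[of 0 "\<lambda>_. 1::complex"]] by (simp add: f_def)
    moreover have "(if n = 0 then 1 else 0) - (1 - of_real a) * (of_real a * z) ^ n = c n * z ^ n" for n
      by (simp add: c_def power_mult_distrib)
    ultimately show ?thesis by simp
  qed
  then show E: "has_expansion f c" by (simp add: has_expansion_def)
  have "norm (c n) \<le> 1 - norm (c 0)" if "n \<ge> 1" for n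
  proof -
    have "(1 - a) * a ^ n \<le> (1 - a) * 1"
      using assms by (intro mult_left_mono power_le_one) auto
    moreover have "norm (c 0) = a" using assms by (simp add: c_def)
    ultimately show ?thesis using norm_c[OF that] by simp
  qed
  with B E show "f \<in> class_B'" unfolding class_B'_def by blast
qed

text \<open>Truncating the series first turns the behaviour at \<open>a = 1\<close> into a derivative of a finite
  sum, so no interchange of limits is needed: the tail is nonnegative and is only added back.\<close>

lemma weighted_geometric_sum_exceeds:
  fixes g :: "nat \<Rightarrow> real" and b p :: real
  assumes nonneg: "\<And>n. 0 \<le> g n" and sm: "summable g" and less: "p * b < suminf g"
  obtains a where "0 < a" "a < 1" "(1 - a powr p) * b < (\<Sum>n. (1 - a) * a ^ Suc n * g n)"
proof -
  have "\<forall>\<^sub>F N in sequentially. p * b < (\<Sum>n<N. g n)"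
    by (rule order_tendstoD(1)[OF summable_LIMSEQ[OF sm] less])
  then obtain N where N: "p * b < (\<Sum>n<N. g n)"
    by (auto simp: eventually_sequentially)
  define S where "S x = (\<Sum>n<N. x ^ Suc n * g n)" for x :: real
  define h where "h x = (1 - x) * S x - (1 - x powr p) * b" for x
  define S' where "S' = (\<Sum>n<N. real (Suc n) * g n)"
  have "(S has_real_derivative S') (at 1)"
    unfolding S_def S'_def by (rule DERIV_sum) (auto intro!: derivative_eq_intros)
  moreover have "((\<lambda>x. x powr p) has_real_derivative p) (at 1)"
    using has_real_derivative_powr[of 1 p] by simp
  ultimately have "(h has_real_derivative p * b - S 1) (at 1)"
    unfolding h_def by (auto intro!: derivative_eq_intros)
  moreover have "p * b - S 1 < 0" using N by (simp add: S_def)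
  ultimately obtain d where d: "d > 0" "\<And>e. 0 < e \<Longrightarrow> e < d \<Longrightarrow> h 1 < h (1 - e)"
    using DERIV_neg_dec_left by blast
  define e where "e = min d 1 / 2"
  define a where "a = 1 - e"
  have e: "0 < e" "e < d" "e < 1" using d(1) by (auto simp: e_def)
  then have a: "0 < a" "a < 1" by (auto simp: a_def)
  have "0 < h a" using d(2)[of e] e by (simp add: h_def a_def)
  then have "(1 - a powr p) * b < (\<Sum>n<N. (1 - a) * a ^ Suc n * g n)"
    by (simp add: h_def S_def sum_distrib_left mult.assoc)
  also have "\<dots> \<le> (\<Sum>n. (1 - a) * a ^ Suc n * g n)"
  proof (rule sum_le_suminf)
    have "(1 - a) * a ^ Suc n \<le> 1 * 1" for n
      using a by (intro mult_mono power_le_one) auto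
    then have "(1 - a) * a ^ Suc n * g n \<le> g n" for n
      using mult_right_mono[OF _ nonneg, of _ 1] by simp
    moreover have "0 \<le> (1 - a) * a ^ Suc n * g n" for n
      using a nonneg by simp
    ultimately show "summable (\<lambda>n. (1 - a) * a ^ Suc n * g n)"
      by (intro summable_comparison_test'[OF sm, of 0]) (simp add: real_norm_def abs_of_nonneg del: power_Suc)
  qed (use a nonneg in auto)
  finally show thesis using that a by blast
qed

lemma majorant_exceeds_if_Phi1_greater:
  assumes "\<phi> \<in> class_F" "r \<in> {0..<1}" "p * \<phi> 0 r < Phi1 \<phi> r"
  obtains f a where "f \<in> class_B'" "has_expansion f a" "\<phi> 0 r < majorant p \<phi> a r"
proof -
  obtain a where a: "0 < a" "a < 1"
    and gt: "(1 - a powr p) * \<phi> 0 r < (\<Sum>n. (1 - a) * a ^ Suc n * \<phi> (Suc n) r)"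
    using weighted_geometric_sum_exceeds[of "\<lambda>n. \<phi> (Suc n) r" p "\<phi> 0 r"]
      class_F_nonneg[OF assms(1,2)] class_F_summable_Suc[OF assms(1,2)] assms(3)
    by (auto simp: Phi1_def)
  define c where "c = (\<lambda>n. if n = 0 then of_real a else - complex_of_real ((1 - a) * a ^ n))"
  have "norm (c (Suc n)) = (1 - a) * a ^ Suc n" for n
    using near_one_in_class_B'(3)[OF a, of "Suc n"] unfolding c_def by simp
  moreover have "norm (c 0) = a" using a by (simp add: c_def)
  ultimately have "majorant p \<phi> c r = a powr p * \<phi> 0 r + (\<Sum>n. (1 - a) * a ^ Suc n * \<phi> (Suc n) r)"
    by (simp only: majorant_def)
  then have "\<phi> 0 r < majorant p \<phi> c r"
    using gt by (simp only: left_diff_distrib)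
  with near_one_in_class_B'(1,2)[OF a] show thesis using that unfolding c_def by blast
qed

theorem theorem1:
  fixes p R :: real and \<phi> :: "nat \<Rightarrow> real \<Rightarrow> real"
  assumes "p \<in> {0<..1}"
    and "\<phi> \<in> class_F"
    and "R \<in> {0<..<1}"
    and "\<phi> 0 R = 1 / p * Phi1 \<phi> R"
    and "\<forall>x\<in>{0<..<R}. \<phi> 0 x \<noteq> 1 / p * Phi1 \<phi> x"
    and "\<forall>r\<in>{0..R}. \<phi> 0 r \<ge> 1 / p * Phi1 \<phi> r"
  shows "(\<forall>f a. f \<in> class_B' \<and> has_expansion f a \<longrightarrow>
            (\<forall>r\<in>{0..R}. majorant p \<phi> a r \<le> \<phi> 0 r)) \<and>
         (\<forall>\<epsilon>>0. {R<..<R + \<epsilon>} \<subseteq> {0<..<1} \<and>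
            (\<forall>x\<in>{R<..<R + \<epsilon>}. \<phi> 0 x < 1 / p * Phi1 \<phi> x) \<longrightarrow>
            (\<forall>R'\<in>{R<..<1}. \<exists>f a. f \<in> class_B' \<and> has_expansion f a \<and>
               (\<exists>r\<in>{R<..<R'}. majorant p \<phi> a r > \<phi> 0 r)))"
proof (intro conjI allI impI ballI)
  have p: "0 < p" "p \<le> 1" and R: "0 < R" "R < 1" using assms(1,3) by auto
  fix f a r
  assume f: "f \<in> class_B' \<and> has_expansion f a" and r: "r \<in> {0..R}"
  have "Phi1 \<phi> r \<le> p * \<phi> 0 r" using assms(6) r p by (auto simp: field_simps)
  then show "majorant p \<phi> a r \<le> \<phi> 0 r"
    using majorant_le_if_Phi1_le[OF assms(2) _ p] f r R by auto
next
  have p: "0 < p" and R: "0 < R" using assms(1,3) by auto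
  fix \<epsilon> R' :: real
  assume "\<epsilon> > 0" and R': "R' \<in> {R<..<1}"
    and \<epsilon>: "{R<..<R + \<epsilon>} \<subseteq> {0<..<1} \<and> (\<forall>x\<in>{R<..<R + \<epsilon>}. \<phi> 0 x < 1 / p * Phi1 \<phi> x)"
  then obtain r where r: "R < r" "r < R'" "r < R + \<epsilon>"
    using dense[of R "min R' (R + \<epsilon>)"] by auto
  with \<epsilon> p have "p * \<phi> 0 r < Phi1 \<phi> r" by (auto simp: field_simps)
  moreover have "r \<in> {0..<1}" using r R R' by auto
  ultimately obtain f a where "f \<in> class_B'" "has_expansion f a" "\<phi> 0 r < majorant p \<phi> a r"
    using majorant_exceeds_if_Phi1_greater[OF assms(2)] by blast
  with r show "\<exists>f a. f \<in> class_B' \<and> has_expansion f a \<and>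
                 (\<exists>r\<in>{R<..<R'}. majorant p \<phi> a r > \<phi> 0 r)"
    by (intro exI[of _ f] exI[of _ a] conjI bexI[of _ r]) auto
qed

end
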